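(* For integers $0\le k<n$, $$\log\frac{\operatorname{LLW}_{k,n}}{\widetilde A_{k,n}}=n\sum_{j=0}^{k-1}\log\left(1-\frac jn\right)-\sum_{r=0}^{kn-1}\log\left(1-\frac r{n^2}\right)-\frac12\sum_{j=0}^{k-1}\frac n{n-j}.$$ Moreover, for every fixed $k$, as $n\to\infty$, $$\log\frac{\operatorname{LLW}_{k,n}}{\widetilde A_{k,n}}=-\frac k{3n}-\frac{k(k+1)}{12n^2}+O_k(n^{-3}),$$ where the implied constant may depend on $k$.
   Context: Write $(x)_r=x(x-1)\cdots(x-r+1)$, $(x)_0=1$, and $H_j=\sum_{r=1}^j1/r$, $H_0=0$. For integers $0\le k<n$ define $$\widetilde A_{k,n}=(n!)^k\left(\frac{(n)_k}{n^k}\right)^n\exp\left\{\tfrac12\bigl[n(H_n-H_{n-k})-k\bigr]\right\},\qquad \operatorname{LLW}_{k,n}=\frac{(n!)^k\,((n)_k)^{2n}}{e^{k/2}\,(n^2)_{kn}}.$$ *)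

theory Defs
  imports "HOL-Analysis.Analysis" "HOL-Library.Landau_Symbols"
begin

definition falling :: "real \<Rightarrow> nat \<Rightarrow> real" where
  "falling x r = (\<Prod>i<r. x - real i)"

text \<open>
  The harmonic numbers \<open>H\<^sub>j\<close> are \<^const>\<open>harm\<close> from the library. The subtraction
  \<open>n - k\<close> is on natural numbers, so \<open>A_tilde k n\<close> has its intended meaning for \<open>k < n\<close> only.
\<close>

definition A_tilde :: "nat \<Rightarrow> nat \<Rightarrow> real" where
  "A_tilde k n =
     fact n ^ k * (falling (real n) k / real n ^ k) ^ n
       * exp (1 / 2 * (real n * (harm n - harm (n - k)) - real k))"

definition LLW :: "nat \<Rightarrow> nat \<Rightarrow> real" where
  "LLW k n =
     (fact n ^ k * falling (real n) k ^ (2 * n))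
       / (exp (real k / 2) * falling (real n ^ 2) (k * n))"

end

theory Submission
  imports Defs
begin

text \<open>
  Pulling the factor \<open>x\<close> out of every term of a falling factorial gives
  \<open>(x)\<^sub>r = x\<^sup>r \<Prod>\<^bsub>i<r\<^esub> (1 - i/x)\<close>. In the quotient \<open>LLW / A_tilde\<close> the factorials, the powers of
  \<open>n\<close> and the factors \<open>exp (k/2)\<close> cancel, and the difference of harmonic numbers
  is the sum of the numbers \<open>1/(n - j)\<close> with \<open>j < k\<close>; taking logarithms proves the exact identity.

  For the asymptotics, fix \<open>k\<close> and let \<open>n \<ge> 2k\<close>. Then the quotients \<open>j/n\<close> and \<open>r/n\<^sup>2\<close> in
  the identity are at most \<open>k/n \<le> 1/2\<close>. Cut off the series of \<open>ln (1 - x)\<close> after \<open>x\<^sup>3\<close> and that of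
  \<open>1/(1 - x)\<close> after \<open>x\<^sup>2\<close>. Since \<open>r\<close> takes \<open>kn\<close> values and the sum over \<open>j\<close> of the logarithms
  carries the factor \<open>n\<close>, an error of order \<open>x\<^sup>4\<close> per logarithm is precisely what is
  needed for a total error of order \<open>n\<^sup>-\<^sup>3\<close>. What is left are power sums of
  exponent at most 3, and inserting their closed forms leaves the two stated terms and
  an explicit rational remainder of order \<open>n\<^sup>-\<^sup>3\<close>
  (\<open>polynomial_part\<close>).
\<close>

section \<open>The exact identity\<close>

lemma falling_eq_power_mult_prod:
  assumes "x \<noteq> 0"
  shows "falling x r = x ^ r * (\<Prod>i<r. 1 - real i / x)"
proof -
  have "falling x r = (\<Prod>i<r. x * (1 - real i / x))"
    unfolding falling_def using assms by (intro prod.cong) (auto simp: field_simps)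
  then show ?thesis by (simp add: prod.distrib)
qed

lemma harm_diff_eq_sum:
  assumes "k \<le> n"
  shows "harm n - harm (n - k) = (\<Sum>j<k. 1 / (real n - real j))"
  using assms
proof (induction k)
  case (Suc k)
  then have "n - k = Suc (n - Suc k)" by simp
  then have "harm (n - k) = harm (n - Suc k) + 1 / (real n - real k)"
    using harm_Suc[of "n - Suc k"] Suc.prems by (simp add: divide_inverse of_nat_diff)
  with Suc show ?case by simp
qed simp

lemma ln_LLW_div_A_tilde:
  assumes "k < n"
  shows "ln (LLW k n / A_tilde k n) =
           real n * (\<Sum>j<k. ln (1 - real j / real n))
           - (\<Sum>r<k * n. ln (1 - real r / (real n)\<^sup>2))
           - 1 / 2 * (\<Sum>j<k. real n / (real n - real j))"
proof -
  define P where "P = (\<Prod>j<k. 1 - real j / real n)"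
  define Q where "Q = (\<Prod>r<k * n. 1 - real r / (real n)\<^sup>2)"
  define S where "S = (\<Sum>j<k. real n / (real n - real j))"
  have n: "real n > 0" using assms by simp
  have Pfac: "1 - real j / real n > 0" if "j < k" for j
    using that assms by (simp add: field_simps)
  have Qfac: "1 - real r / (real n)\<^sup>2 > 0" if "r < k * n" for r
  proof -
    have "r < n * n" using that assms by (meson less_imp_le mult_le_mono1 order_less_le_trans)
    then have "real r < real n * real n" by (metis of_nat_less_iff of_nat_mult)
    then show ?thesis using n by (simp add: power2_eq_square)
  qed
  have P: "P > 0" unfolding P_def using Pfac by (intro prod_pos) auto
  have Q: "Q > 0" unfolding Q_def using Qfac by (intro prod_pos) auto
  have fn: "falling (real n) k = real n ^ k * P"
    unfolding P_def using n by (intro falling_eq_power_mult_prod) simp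
  have fnn: "falling (real n ^ 2) (k * n) = real n ^ (k * n) * real n ^ (k * n) * Q"
    unfolding Q_def using n
    by (subst falling_eq_power_mult_prod) (simp_all add: power2_eq_square power_mult_distrib)
  have S: "real n * (harm n - harm (n - k)) = S"
    unfolding S_def using assms by (simp add: harm_diff_eq_sum sum_distrib_left)
  have A: "A_tilde k n = fact n ^ k * P ^ n * (exp (S / 2) / exp (real k / 2))"
    unfolding A_tilde_def S using n by (simp add: fn diff_divide_distrib flip: exp_diff)
  have pow: "falling (real n) k ^ (2 * n) = real n ^ (k * n) * real n ^ (k * n) * P ^ n * P ^ n"
    unfolding fn by (simp add: mult_2 power_add power_mult power_mult_distrib)
  have L: "LLW k n = fact n ^ k * P ^ n * P ^ n / (exp (real k / 2) * Q)"
    unfolding LLW_def pow fnn using n by simp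
  have "LLW k n / A_tilde k n = P ^ n / Q / exp (S / 2)"
    unfolding A L using P Q by (simp add: field_simps)
  then have "ln (LLW k n / A_tilde k n) = real n * ln P - ln Q - 1 / 2 * S"
    using P Q by (simp add: ln_div ln_mult ln_realpow)
  moreover have "ln P = (\<Sum>j<k. ln (1 - real j / real n))"
    unfolding P_def by (rule ln_prod) (simp, metis Pfac lessThan_iff less_irrefl)
  moreover have "ln Q = (\<Sum>r<k * n. ln (1 - real r / (real n)\<^sup>2))"
    unfolding Q_def by (rule ln_prod) (simp, metis Qfac lessThan_iff less_irrefl)
  ultimately show ?thesis by (simp add: S_def)
qed

section \<open>Truncated series\<close>

text \<open>
  The derivative of the remainder is \<open>1/(1 - x) - 1 - x - x\<^sup>2 = x\<^sup>3/(1 - x)\<close>, which lies between 0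
  and \<open>2x\<^sup>3\<close> for \<open>x \<le> 1/2\<close>; integrating from 0 gives the bound.
\<close>

lemma abs_ln_one_minus_taylor_le:
  fixes x :: real
  assumes "0 \<le> x" "x \<le> 1 / 2"
  shows "\<bar>ln (1 - x) + x + x ^ 2 / 2 + x ^ 3 / 3\<bar> \<le> x ^ 4 / 2"
proof -
  define f where "f = (\<lambda>t::real. - ln (1 - t) - t - t ^ 2 / 2 - t ^ 3 / 3)"
  define g where "g = (\<lambda>t::real. t ^ 4 / 2 - f t)"
  have f': "(f has_real_derivative t ^ 3 / (1 - t)) (at t)" if "t \<le> x" for t
    unfolding f_def using that assms
    by (auto intro!: derivative_eq_intros simp: field_simps power2_eq_square power3_eq_cube)
  have g': "(g has_real_derivative 2 * t ^ 3 - t ^ 3 / (1 - t)) (at t)" if "t \<le> x" for t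
    unfolding g_def using that by (auto intro!: derivative_eq_intros f')
  have "f 0 \<le> f x"
  proof (rule DERIV_nonneg_imp_nondecreasing[OF assms(1)])
    fix t assume "0 \<le> t" "t \<le> x"
    then show "\<exists>y. (f has_real_derivative y) (at t) \<and> 0 \<le> y"
      using f'[of t] assms by (intro exI[of _ "t ^ 3 / (1 - t)"]) auto
  qed
  moreover have "g 0 \<le> g x"
  proof (rule DERIV_nonneg_imp_nondecreasing[OF assms(1)])
    fix t assume t: "0 \<le> t" "t \<le> x"
    then have "t ^ 3 * 1 \<le> t ^ 3 * (2 * (1 - t))"
      using assms by (intro mult_left_mono) auto
    then have "t ^ 3 / (1 - t) \<le> 2 * t ^ 3"
      using t assms by (simp add: field_simps)
    then show "\<exists>y. (g has_real_derivative y) (at t) \<and> 0 \<le> y"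
      using g'[of t] t by (intro exI[of _ "2 * t ^ 3 - t ^ 3 / (1 - t)"]) auto
  qed
  ultimately show ?thesis by (simp add: f_def g_def)
qed

lemma abs_geometric_remainder_le:
  fixes x :: real
  assumes "0 \<le> x" "x \<le> 1 / 2"
  shows "\<bar>1 / (1 - x) - (1 + x + x ^ 2)\<bar> \<le> 2 * x ^ 3"
proof -
  have "1 / (1 - x) - (1 + x + x ^ 2) = x ^ 3 / (1 - x)"
    using assms by (simp add: field_simps power2_eq_square power3_eq_cube)
  moreover have "x ^ 3 * 1 \<le> x ^ 3 * (2 * (1 - x))"
    using assms by (intro mult_left_mono) auto
  then have "x ^ 3 / (1 - x) \<le> 2 * x ^ 3"
    using assms by (simp add: field_simps)
  ultimately show ?thesis using assms by simp
qed

lemma abs_sum_le_card_mult: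
  fixes f :: "nat \<Rightarrow> real"
  assumes "\<And>i. i < m \<Longrightarrow> \<bar>f i\<bar> \<le> c"
  shows "\<bar>\<Sum>i<m. f i\<bar> \<le> real m * c"
  using order_trans[OF sum_abs sum_bounded_above[of "{..<m}" "\<lambda>i. \<bar>f i\<bar>" c]] assms by simp

text \<open>
  A uniform bound \<open>c\<close> on the quotients serves both logarithmic sums of the exact identity: with
  \<open>y = n\<close>, \<open>m = k\<close> and with \<open>y = n\<^sup>2\<close>, \<open>m = kn\<close>, the choice \<open>c = k/n\<close> is possible.
\<close>

lemma abs_sum_ln_one_minus_taylor_le:
  fixes y c :: real
  assumes "y > 0" "c \<le> 1 / 2" "\<And>i. i < m \<Longrightarrow> real i / y \<le> c"
  shows "\<bar>(\<Sum>i<m. ln (1 - real i / y))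
           + ((\<Sum>i<m. real i) / y + (\<Sum>i<m. real i ^ 2) / (2 * y ^ 2)
              + (\<Sum>i<m. real i ^ 3) / (3 * y ^ 3))\<bar> \<le> real m * (c ^ 4 / 2)"
proof -
  have "\<bar>\<Sum>i<m. ln (1 - real i / y) + real i / y + (real i / y) ^ 2 / 2 + (real i / y) ^ 3 / 3\<bar>
          \<le> real m * (c ^ 4 / 2)"
  proof (rule abs_sum_le_card_mult)
    fix i assume "i < m"
    then have i: "0 \<le> real i / y" "real i / y \<le> c" using assms by auto
    have "\<bar>ln (1 - real i / y) + real i / y + (real i / y) ^ 2 / 2 + (real i / y) ^ 3 / 3\<bar>
                 \<le> (real i / y) ^ 4 / 2"
      by (rule abs_ln_one_minus_taylor_le[OF i(1) order_trans[OF i(2) assms(2)]])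
    also have "\<dots> \<le> c ^ 4 / 2"
      using i by (intro divide_right_mono power_mono) auto
    finally show "\<bar>ln (1 - real i / y) + real i / y + (real i / y) ^ 2 / 2
                     + (real i / y) ^ 3 / 3\<bar> \<le> c ^ 4 / 2" .
  qed
  then show ?thesis
    by (simp add: sum.distrib sum_divide_distrib power_divide add.assoc mult.commute)
qed

lemma abs_sum_inverse_taylor_le:
  fixes y c :: real
  assumes "y > 0" "c \<le> 1 / 2" "\<And>i. i < m \<Longrightarrow> real i / y \<le> c"
  shows "\<bar>(\<Sum>i<m. y / (y - real i))
           - (real m + (\<Sum>i<m. real i) / y + (\<Sum>i<m. real i ^ 2) / y ^ 2)\<bar> \<le> real m * (2 * c ^ 3)"
proof -
  have "\<bar>\<Sum>i<m. y / (y - real i) - (1 + real i / y + (real i / y) ^ 2)\<bar> \<le> real m * (2 * c ^ 3)"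
  proof (rule abs_sum_le_card_mult)
    fix i assume "i < m"
    then have i: "0 \<le> real i / y" "real i / y \<le> c" using assms by auto
    have "y / (y - real i) = 1 / (1 - real i / y)"
      using assms(1) by (simp add: field_simps)
    then have "\<bar>y / (y - real i) - (1 + real i / y + (real i / y) ^ 2)\<bar> \<le> 2 * (real i / y) ^ 3"
      using abs_geometric_remainder_le[OF i(1) order_trans[OF i(2) assms(2)]] by simp
    also have "\<dots> \<le> 2 * c ^ 3"
      using i by (intro mult_left_mono power_mono) auto
    finally show "\<bar>y / (y - real i) - (1 + real i / y + (real i / y) ^ 2)\<bar> \<le> 2 * c ^ 3" .
  qed
  then show ?thesis
    by (simp add: sum.distrib sum_subtractf sum_divide_distrib power_divide)
qed

section \<open>Power sums and the rational main term\<close>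

lemma sum_of_nat_lessThan: "(\<Sum>i<m. real i) = real m * (real m - 1) / 2"
  by (induction m) (auto simp: field_simps)

lemma sum_of_nat_squares_lessThan:
  "(\<Sum>i<m. real i ^ 2) = real m * (real m - 1) * (2 * real m - 1) / 6"
  by (induction m) (auto simp: field_simps power2_eq_square)

lemma sum_of_nat_cubes_lessThan:
  "(\<Sum>i<m. real i ^ 3) = real m ^ 2 * (real m - 1) ^ 2 / 4"
  by (induction m) (auto simp: field_simps power2_eq_square power3_eq_cube)

text \<open>
  The left-hand side is the right-hand side of the exact identity with all three series truncated.
  The constant terms cancel, the terms of order \<open>1/n\<close> and \<open>1/n\<^sup>2\<close> combine to the stated ones,
  and the rest comes from the lower-order terms of the power sums over \<open>r < k * n\<close>.
\<close>

lemma polynomial_part: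
  assumes "n > 0"
  shows "- real n * ((\<Sum>j<k. real j) / real n + (\<Sum>j<k. real j ^ 2) / (2 * real n ^ 2)
              + (\<Sum>j<k. real j ^ 3) / (3 * real n ^ 3))
         + ((\<Sum>r<k * n. real r) / (real n)\<^sup>2 + (\<Sum>r<k * n. real r ^ 2) / (2 * ((real n)\<^sup>2) ^ 2)
              + (\<Sum>r<k * n. real r ^ 3) / (3 * ((real n)\<^sup>2) ^ 3))
         - 1 / 2 * (real k + (\<Sum>j<k. real j) / real n + (\<Sum>j<k. real j ^ 2) / (real n) ^ 2)
         = - (real k / (3 * real n)) - real k * (real k + 1) / (12 * (real n)\<^sup>2)
           + (real k / 12 - real k ^ 3 / 6 + real k ^ 2 / (12 * real n)) / real n ^ 3"
  unfolding sum_of_nat_lessThan sum_of_nat_squares_lessThan sum_of_nat_cubes_lessThan of_nat_mult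
  using assms by (simp add: divide_simps) algebra

section \<open>The asymptotic expansion\<close>

text \<open>
  With \<open>c = k/n\<close>, each of the two logarithmic sums contributes an error of at most
  \<open>kn \<cdot> c\<^sup>4/2 = k\<^sup>5/(2n\<^sup>3)\<close>, and half the sum of reciprocals at most \<open>k c\<^sup>3 = k\<^sup>4/n\<^sup>3\<close>;
  the other three terms of the constant bound the rational remainder.
\<close>

lemma abs_ln_LLW_div_A_tilde_expansion_le:
  assumes "n > 0" "2 * k \<le> n"
  shows "\<bar>ln (LLW k n / A_tilde k n)
            - (- (real k / (3 * real n)) - real k * (real k + 1) / (12 * (real n)\<^sup>2))\<bar>
         \<le> (real k ^ 5 + real k ^ 4 + real k / 12 + real k ^ 3 / 6 + real k ^ 2 / 12)
              * (1 / real n ^ 3)"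
proof -
  define c where "c = real k / real n"
  have n: "real n > 0" "real n \<ge> 1" using assms by auto
  have c: "c \<le> 1 / 2" using assms n by (simp add: c_def field_simps)
  have Pc: "real j / real n \<le> c" if "j < k" for j
    using that n by (simp add: c_def divide_right_mono)
  have Qc: "real r / (real n)\<^sup>2 \<le> c" if "r < k * n" for r
  proof -
    have "real r \<le> real k * real n" using that by (metis less_imp_le of_nat_le_iff of_nat_mult)
    then show ?thesis using n by (simp add: c_def field_simps power2_eq_square)
  qed
  define A where "A = (\<Sum>j<k. ln (1 - real j / real n))"
  define B where "B = (\<Sum>r<k * n. ln (1 - real r / (real n)\<^sup>2))"
  define C where "C = (\<Sum>j<k. real n / (real n - real j))"
  define a where "a = (\<Sum>j<k. real j) / real n + (\<Sum>j<k. real j ^ 2) / (2 * real n ^ 2)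
              + (\<Sum>j<k. real j ^ 3) / (3 * real n ^ 3)"
  define b where "b = (\<Sum>r<k * n. real r) / (real n)\<^sup>2
              + (\<Sum>r<k * n. real r ^ 2) / (2 * ((real n)\<^sup>2) ^ 2)
              + (\<Sum>r<k * n. real r ^ 3) / (3 * ((real n)\<^sup>2) ^ 3)"
  define d where "d = real k + (\<Sum>j<k. real j) / real n + (\<Sum>j<k. real j ^ 2) / (real n) ^ 2"
  define T where "T = - (real k / (3 * real n)) - real k * (real k + 1) / (12 * (real n)\<^sup>2)"
  define R where "R = (real k / 12 - real k ^ 3 / 6 + real k ^ 2 / (12 * real n)) / real n ^ 3"
  have "\<bar>A + a\<bar> \<le> real k * (c ^ 4 / 2)"
    unfolding A_def a_def by (rule abs_sum_ln_one_minus_taylor_le[OF n(1) c Pc])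
  then have "real n * \<bar>A + a\<bar> \<le> real n * (real k * (c ^ 4 / 2))"
    using n by (intro mult_left_mono) auto
  also have "real n * (real k * (c ^ 4 / 2)) = real k ^ 5 / 2 / real n ^ 3"
    using n by (simp add: c_def field_simps eval_nat_numeral)
  finally have A: "\<bar>real n * (A + a)\<bar> \<le> real k ^ 5 / 2 / real n ^ 3"
    using n by (simp add: abs_mult)
  have "\<bar>B + b\<bar> \<le> real (k * n) * (c ^ 4 / 2)"
    unfolding B_def b_def using n by (intro abs_sum_ln_one_minus_taylor_le[OF _ c Qc]) auto
  then have B: "\<bar>B + b\<bar> \<le> real k ^ 5 / 2 / real n ^ 3"
    using n by (simp add: c_def field_simps eval_nat_numeral)
  have "\<bar>C - d\<bar> \<le> real k * (2 * c ^ 3)"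
    unfolding C_def d_def by (rule abs_sum_inverse_taylor_le[OF n(1) c Pc])
  then have C: "\<bar>C - d\<bar> \<le> 2 * (real k ^ 4 / real n ^ 3)"
    using n by (simp add: c_def field_simps eval_nat_numeral)
  have "real k ^ 2 / (12 * real n) \<le> real k ^ 2 / 12"
    using n by (intro divide_left_mono) auto
  moreover have "0 \<le> real k ^ 2 / (12 * real n)" "0 \<le> real k ^ 3" by auto
  ultimately have "\<bar>real k / 12 - real k ^ 3 / 6 + real k ^ 2 / (12 * real n)\<bar>
        \<le> real k / 12 + real k ^ 3 / 6 + real k ^ 2 / 12"
    unfolding abs_le_iff by (intro conjI) linarith+
  then have R: "\<bar>R\<bar> \<le> (real k / 12 + real k ^ 3 / 6 + real k ^ 2 / 12) / real n ^ 3"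
    unfolding R_def using n by (simp add: divide_right_mono)
  \<comment> \<open>Stated for free variables, because linear arithmetic would multiply out \<open>n * (A + a)\<close>.\<close>
  have triangle: "\<bar>x - y - 1 / 2 * z + w\<bar> \<le> p + q + s + t"
    if "\<bar>x\<bar> \<le> p" "\<bar>y\<bar> \<le> q" "\<bar>z\<bar> \<le> 2 * s" "\<bar>w\<bar> \<le> t" for x y z w p q s t :: real
    using that by linarith
  have "k < n" using assms by simp
  then have "ln (LLW k n / A_tilde k n) = real n * A - B - 1 / 2 * C"
    unfolding A_def B_def C_def by (rule ln_LLW_div_A_tilde)
  moreover have "- real n * a + b - 1 / 2 * d = T + R"
    unfolding a_def b_def d_def T_def R_def using assms by (intro polynomial_part)
  ultimately have "ln (LLW k n / A_tilde k n) - T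
      = real n * A - B - 1 / 2 * C - (- real n * a + b - 1 / 2 * d) + R"
    by simp
  also have "\<dots> = real n * (A + a) - (B + b) - 1 / 2 * (C - d) + R"
    by (simp add: algebra_simps diff_divide_distrib)
  finally have "ln (LLW k n / A_tilde k n) - T
      = real n * (A + a) - (B + b) - 1 / 2 * (C - d) + R" .
  then have "\<bar>ln (LLW k n / A_tilde k n) - T\<bar>
      \<le> real k ^ 5 / 2 / real n ^ 3 + real k ^ 5 / 2 / real n ^ 3 + real k ^ 4 / real n ^ 3
        + (real k / 12 + real k ^ 3 / 6 + real k ^ 2 / 12) / real n ^ 3"
    using triangle[OF A B C R] by simp
  also have "\<dots> = (real k ^ 5 + real k ^ 4 + real k / 12 + real k ^ 3 / 6 + real k ^ 2 / 12)
              * (1 / real n ^ 3)"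
    by (simp add: add_divide_distrib)
  finally show ?thesis unfolding T_def .
qed

theorem proposition1p4:
  shows "(\<forall>k n :: nat. k < n \<longrightarrow>
            ln (LLW k n / A_tilde k n) =
              real n * (\<Sum>j<k. ln (1 - real j / real n))
              - (\<Sum>r<k * n. ln (1 - real r / (real n)\<^sup>2))
              - 1 / 2 * (\<Sum>j<k. real n / (real n - real j)))
       \<and> (\<forall>k :: nat.
            (\<lambda>n :: nat. ln (LLW k n / A_tilde k n)
                - (- (real k / (3 * real n)) - real k * (real k + 1) / (12 * (real n)\<^sup>2)))
              \<in> O(\<lambda>n. 1 / real n ^ 3))"
proof (intro conjI allI impI)
  fix k :: nat
  show "(\<lambda>n :: nat. ln (LLW k n / A_tilde k n)
                - (- (real k / (3 * real n)) - real k * (real k + 1) / (12 * (real n)\<^sup>2)))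
              \<in> O(\<lambda>n. 1 / real n ^ 3)"
    \<comment> \<open>The successor keeps \<open>n\<close> positive when \<open>k = 0\<close>.\<close>
  proof (rule bigoI, rule eventually_sequentiallyI)
    fix n assume "Suc (2 * k) \<le> n"
    then show "norm (ln (LLW k n / A_tilde k n)
                - (- (real k / (3 * real n)) - real k * (real k + 1) / (12 * (real n)\<^sup>2)))
        \<le> (real k ^ 5 + real k ^ 4 + real k / 12 + real k ^ 3 / 6 + real k ^ 2 / 12)
              * norm (1 / real n ^ 3)"
      using abs_ln_LLW_div_A_tilde_expansion_le[of n k] by simp
  qed
qed (rule ln_LLW_div_A_tilde)

end
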